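(* Let $\mathcal{C}$ be an algebraic curve arrangement in $\mathbb{C}^2$, and let $\gamma_0\in\mathcal{C}$ be a distinguished smooth component that intersects the remaining arrangement $\mathcal{C}'=\mathcal{C}\setminus\{\gamma_0\}$ transversally. Let $\mathcal{C}''=\mathcal{C}'\cap\gamma_0$ be the restricted arrangement, consisting of $v_0$ distinct reduced points. Then the class of the complement $\mathcal{M}(\mathcal{C})=\mathbb{C}^2\setminus\mathcal{C}$ in $K_0(\operatorname{Var}_{\mathbb{C}})$ satisfies $$[\mathcal{M}(\mathcal{C})]=[\mathcal{M}(\mathcal{C}')]-[\gamma_0\setminus\mathcal{C}''].$$
   Context: $K_0(\operatorname{Var}_{\mathbb{C}})$ is the Grothendieck ring of complex algebraic varieties: it is generated by isomorphism classes $[X]$ of complex varieties modulo the scissor relations $[X]=[Z]+[X\setminus Z]$ for closed subvarieties $Z\subset X$. An algebraic curve arrangement is a finite set of distinct algebraic curves (no common components) in $\mathbb{C}^2$; in expressions such as $\mathbb{C}^2\setminus\mathcal{C}$ and $\mathcal{C}'\cap\gamma_0$ the arrangement is identified with the union of its curves, and $\mathcal{M}(\mathcal{C}')=\mathbb{C}^2\setminus\mathcal{C}'$. With $\mathbb{L}=[\mathbb{A}^1_{\mathbb{C}}]$, the class of the complement of a closed $X\subset\mathbb{C}^2$ is $[\mathbb{C}^2\setminus X]=\mathbb{L}^2-[X]$. *)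

theory Defs
  imports "HOL-Analysis.Analysis" "HOL-Algebra.Ring" "HOL-Algebra.Free_Abelian_Groups"
begin

section \<open>Spaces with functions\<close>

text \<open>
  Complex varieties are taken in the classical sense (Serre's FAC): a reduced separated scheme of
  finite type over the complex numbers is the same thing as a separated space with a sheaf of
  complex-valued functions that has a finite cover by open affine algebraic sets. Varieties need
  not be irreducible.

  In \<open>regular X U f\<close> only the values of \<open>f\<close> on \<open>U\<close> matter, and only for open \<open>U\<close>.
\<close>

record 'a fun_space =
  opens :: "'a topology"
  regular :: "'a set \<Rightarrow> ('a \<Rightarrow> complex) \<Rightarrow> bool"

abbreviation points :: "('a, 'm) fun_space_scheme \<Rightarrow> 'a set" where
  "points X \<equiv> topspace (opens X)"

definition function_sheaf :: "'a fun_space \<Rightarrow> bool" where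
  "function_sheaf X \<longleftrightarrow>
     (\<forall>U f g. openin (opens X) U \<and> regular X U f \<and> (\<forall>x\<in>U. f x = g x) \<longrightarrow> regular X U g) \<and>
     (\<forall>U V f. openin (opens X) U \<and> openin (opens X) V \<and> V \<subseteq> U \<and> regular X U f \<longrightarrow> regular X V f) \<and>
     (\<forall>\<U> f. (\<forall>U\<in>\<U>. openin (opens X) U \<and> regular X U f) \<longrightarrow> regular X (\<Union>\<U>) f)"

definition morphism :: "'a fun_space \<Rightarrow> 'b fun_space \<Rightarrow> ('a \<Rightarrow> 'b) \<Rightarrow> bool" where
  "morphism X Y \<phi> \<longleftrightarrow>
     continuous_map (opens X) (opens Y) \<phi> \<and>
     (\<forall>V f. openin (opens Y) V \<and> regular Y V f \<longrightarrow> regular X (points X \<inter> \<phi> -` V) (f \<circ> \<phi>))"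

definition isomorphic :: "'a fun_space \<Rightarrow> 'b fun_space \<Rightarrow> bool" where
  "isomorphic X Y \<longleftrightarrow>
     (\<exists>\<phi> \<psi>. morphism X Y \<phi> \<and> morphism Y X \<psi> \<and>
        (\<forall>x\<in>points X. \<psi> (\<phi> x) = x) \<and> (\<forall>y\<in>points Y. \<phi> (\<psi> y) = y))"

text \<open>
  The structure induced on a subset: subspace topology, and the functions that are locally
  restrictions of regular functions of the ambient space. For open subsets of a sheaf this is the
  restricted sheaf, for closed subsets of a variety the reduced closed subvariety structure.
\<close>

definition induced :: "'a fun_space \<Rightarrow> 'a set \<Rightarrow> 'a fun_space" where
  "induced X Y =
     \<lparr>opens = subtopology (opens X) Y,
      regular = (\<lambda>V f. \<forall>x\<in>V. \<exists>U g. openin (opens X) U \<and> x \<in> U \<and> regular X U g \<and>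
                                  (\<forall>y\<in>V \<inter> U. f y = g y))\<rparr>"

text \<open>
  The product in the category of spaces with functions: if \<open>h\<close> is a finite sum of products
  \<open>a x * b y\<close> with \<open>a\<close> regular on \<open>U\<close> and \<open>b\<close> regular on \<open>V\<close>, then its nonvanishing locus in
  \<open>U \<times> V\<close> is a basic open set, and regular functions are locally quotients of such \<open>h\<close>.
\<close>

definition tensor_function ::
  "'a fun_space \<Rightarrow> 'b fun_space \<Rightarrow> 'a set \<Rightarrow> 'b set \<Rightarrow> ('a \<times> 'b \<Rightarrow> complex) \<Rightarrow> bool" where
  "tensor_function X Y U V h \<longleftrightarrow>
     openin (opens X) U \<and> openin (opens Y) V \<and>
     (\<exists>(n::nat) a b. (\<forall>i<n. regular X U (a i) \<and> regular Y V (b i)) \<and>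
        (\<forall>x\<in>U. \<forall>y\<in>V. h (x, y) = (\<Sum>i<n. a i x * b i y)))"

definition fun_space_prod :: "'a fun_space \<Rightarrow> 'b fun_space \<Rightarrow> ('a \<times> 'b) fun_space" where
  "fun_space_prod X Y =
     \<lparr>opens = topology_generated_by
        {{z \<in> U \<times> V. h z \<noteq> 0} | U V h. tensor_function X Y U V h},
      regular = (\<lambda>W f. \<forall>z\<in>W. \<exists>U V h k. tensor_function X Y U V h \<and> tensor_function X Y U V k \<and>
         z \<in> U \<times> V \<and> k z \<noteq> 0 \<and> (\<forall>w\<in>W \<inter> (U \<times> V). k w \<noteq> 0 \<longrightarrow> f w = h w / k w))\<rparr>"


section \<open>Affine space and complex varieties\<close>

text \<open>
  The points of complex affine \<open>n\<close>-space are the sequences supported on \<open>{..<n}\<close>, so that all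
  affine spaces share one type of points. A polynomial function of infinitely many coordinates
  restricts to a polynomial function of the first \<open>n\<close> ones.
\<close>

type_synonym point = "nat \<Rightarrow> complex"

inductive_set polynomial_functions :: "(point \<Rightarrow> complex) set" where
  const: "(\<lambda>x. c) \<in> polynomial_functions"
| coordinate: "(\<lambda>x. x i) \<in> polynomial_functions"
| add: "p \<in> polynomial_functions \<Longrightarrow> q \<in> polynomial_functions
        \<Longrightarrow> (\<lambda>x. p x + q x) \<in> polynomial_functions"
| mult: "p \<in> polynomial_functions \<Longrightarrow> q \<in> polynomial_functions
         \<Longrightarrow> (\<lambda>x. p x * q x) \<in> polynomial_functions"

definition affine_points :: "nat \<Rightarrow> point set" where
  "affine_points n = {x. \<forall>i\<ge>n. x i = 0}"

text \<open>The Zariski topology is generated by the principal open sets.\<close>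

definition affine_space :: "nat \<Rightarrow> point fun_space" where
  "affine_space n =
     \<lparr>opens = topology_generated_by
        {{x \<in> affine_points n. p x \<noteq> 0} | p. p \<in> polynomial_functions},
      regular = (\<lambda>U f. \<forall>x\<in>U. \<exists>p\<in>polynomial_functions. \<exists>q\<in>polynomial_functions.
         q x \<noteq> 0 \<and> (\<forall>y\<in>U. q y \<noteq> 0 \<longrightarrow> f y = p y / q y))\<rparr>"

definition affine_variety :: "'a fun_space \<Rightarrow> bool" where
  "affine_variety X \<longleftrightarrow>
     (\<exists>n Z. closedin (opens (affine_space n)) Z \<and> isomorphic X (induced (affine_space n) Z))"

definition separated :: "'a fun_space \<Rightarrow> bool" where
  "separated X \<longleftrightarrow> closedin (opens (fun_space_prod X X)) {(x, x) | x. x \<in> points X}"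

definition complex_variety :: "'a fun_space \<Rightarrow> bool" where
  "complex_variety X \<longleftrightarrow>
     function_sheaf X \<and>
     (\<exists>\<U>. finite \<U> \<and> \<Union>\<U> = points X \<and>
        (\<forall>U\<in>\<U>. openin (opens X) U \<and> affine_variety (induced X U))) \<and>
     separated X"

definition closed_subvariety :: "'a fun_space \<Rightarrow> 'a set \<Rightarrow> bool" where
  "closed_subvariety X Z \<longleftrightarrow> closedin (opens X) Z \<and> complex_variety (induced X Z)"

definition open_subvariety :: "'a fun_space \<Rightarrow> 'a set \<Rightarrow> bool" where
  "open_subvariety X U \<longleftrightarrow> openin (opens X) U \<and> complex_variety (induced X U)"


section \<open>The Grothendieck ring of complex varieties\<close>

text \<open>
  A complex variety has at most continuum many points, hence is isomorphic to one whose points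
  have type \<^typ>\<open>point\<close>. So the varieties on this type represent all isomorphism classes, and
  the class of a variety on any type can be formed.
\<close>

definition iso_class :: "'a fun_space \<Rightarrow> point fun_space set" where
  "iso_class X = {Y. complex_variety Y \<and> isomorphic X Y}"

definition iso_classes :: "point fun_space set set" where
  "iso_classes = {iso_class X | X :: point fun_space. complex_variety X}"

abbreviation class_group :: "(point fun_space set \<Rightarrow>\<^sub>0 int) monoid" where
  "class_group \<equiv> free_Abelian_group iso_classes"

text \<open>
  For a variety \<open>X\<close> and closed \<open>Z\<close>, the induced structures on \<open>Z\<close> and on its complement are
  always varieties; the two conditions beyond closedness of \<open>Z\<close> do not restrict the relations.
\<close>

definition scissor_relations :: "(point fun_space set \<Rightarrow>\<^sub>0 int) set" where
  "scissor_relations =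
     {frag_of (iso_class X)
        - (frag_of (iso_class (induced X Z)) + frag_of (iso_class (induced X (points X - Z))))
      | (X :: point fun_space) Z.
      complex_variety X \<and> closed_subvariety X Z \<and> open_subvariety X (points X - Z)}"

definition scissor_subgroup :: "(point fun_space set \<Rightarrow>\<^sub>0 int) set" where
  "scissor_subgroup = generate class_group scissor_relations"

text \<open>The product of isomorphism classes, and its bilinear extension to the free abelian group.\<close>

definition iso_class_mult ::
  "point fun_space set \<Rightarrow> point fun_space set \<Rightarrow> point fun_space set" where
  "iso_class_mult s t = iso_class (fun_space_prod (SOME X. X \<in> s) (SOME Y. Y \<in> t))"

definition class_mult ::
  "(point fun_space set \<Rightarrow>\<^sub>0 int) \<Rightarrow> (point fun_space set \<Rightarrow>\<^sub>0 int) \<Rightarrow> (point fun_space set \<Rightarrow>\<^sub>0 int)" where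
  "class_mult a b = frag_extend (\<lambda>s. frag_extend (\<lambda>t. frag_of (iso_class_mult s t)) b) a"

definition K0_Var :: "(point fun_space set \<Rightarrow>\<^sub>0 int) set ring" where
  "K0_Var =
     \<lparr>carrier = carrier (class_group Mod scissor_subgroup),
      monoid.mult = (\<lambda>A B. \<Union>a\<in>A. \<Union>b\<in>B. scissor_subgroup #>\<^bsub>class_group\<^esub> class_mult a b),
      monoid.one = scissor_subgroup #>\<^bsub>class_group\<^esub> frag_of (iso_class (affine_space 0)),
      ring.zero = \<one>\<^bsub>class_group Mod scissor_subgroup\<^esub>,
      ring.add = (\<otimes>\<^bsub>class_group Mod scissor_subgroup\<^esub>)\<rparr>"

definition K0_class :: "'a fun_space \<Rightarrow> (point fun_space set \<Rightarrow>\<^sub>0 int) set" where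
  "K0_class X = scissor_subgroup #>\<^bsub>class_group\<^esub> frag_of (iso_class X)"


section \<open>Curve arrangements in the affine plane\<close>

definition algebraic_curve :: "point set \<Rightarrow> bool" where
  "algebraic_curve \<gamma> \<longleftrightarrow>
     (\<exists>f\<in>polynomial_functions. \<not> f constant_on affine_points 2 \<and>
        \<gamma> = {x \<in> affine_points 2. f x = 0})"

definition irreducible_set :: "'a topology \<Rightarrow> 'a set \<Rightarrow> bool" where
  "irreducible_set T S \<longleftrightarrow>
     S \<subseteq> topspace T \<and> S \<noteq> {} \<and>
     (\<forall>A B. closedin T A \<and> closedin T B \<and> S \<subseteq> A \<union> B \<longrightarrow> S \<subseteq> A \<or> S \<subseteq> B)"

definition irreducible_components :: "'a topology \<Rightarrow> 'a set \<Rightarrow> 'a set set" where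
  "irreducible_components T S =
     {Z. Z \<subseteq> S \<and> irreducible_set T Z \<and> (\<forall>Y. Y \<subseteq> S \<and> irreducible_set T Y \<and> Z \<subseteq> Y \<longrightarrow> Y = Z)}"

definition curve_arrangement :: "point set set \<Rightarrow> bool" where
  "curve_arrangement \<C> \<longleftrightarrow>
     finite \<C> \<and> (\<forall>\<gamma>\<in>\<C>. algebraic_curve \<gamma>) \<and>
     (\<forall>\<gamma>\<in>\<C>. \<forall>\<delta>\<in>\<C>. \<gamma> \<noteq> \<delta> \<longrightarrow>
        irreducible_components (opens (affine_space 2)) \<gamma> \<inter>
        irreducible_components (opens (affine_space 2)) \<delta> = {})"

text \<open>
  The Zariski tangent space: the common kernel of the differentials at \<open>p\<close> of all polynomials
  vanishing on the (reduced) curve.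
\<close>

definition tangent_space :: "point set \<Rightarrow> point \<Rightarrow> point set" where
  "tangent_space \<gamma> p =
     {v \<in> affine_points 2. \<forall>f\<in>polynomial_functions. (\<forall>x\<in>\<gamma>. f x = 0) \<longrightarrow>
        deriv (\<lambda>t. f (\<lambda>i. p i + t * v i)) 0 = 0}"

definition smooth_at :: "point set \<Rightarrow> point \<Rightarrow> bool" where
  "smooth_at \<gamma> p \<longleftrightarrow> (\<exists>v. v \<noteq> (\<lambda>i. 0) \<and> tangent_space \<gamma> p = {(\<lambda>i. c * v i) | c. True})"

definition smooth_curve :: "point set \<Rightarrow> bool" where
  "smooth_curve \<gamma> \<longleftrightarrow> (\<forall>p\<in>\<gamma>. smooth_at \<gamma> p)"

definition intersect_transversally :: "point set \<Rightarrow> point set \<Rightarrow> bool" where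
  "intersect_transversally \<gamma> \<delta> \<longleftrightarrow>
     (\<forall>p\<in>\<gamma> \<inter> \<delta>. smooth_at \<gamma> p \<and> smooth_at \<delta> p \<and>
        {(\<lambda>i. v i + w i) | v w. v \<in> tangent_space \<gamma> p \<and> w \<in> tangent_space \<delta> p} = affine_points 2)"

definition complement :: "point set set \<Rightarrow> point set" where
  "complement \<C> = affine_points 2 - \<Union>\<C>"

text \<open>The subsets of the plane occurring below are locally closed, with the induced structure.\<close>

definition plane_class :: "point set \<Rightarrow> (point fun_space set \<Rightarrow>\<^sub>0 int) set" where
  "plane_class S = K0_class (induced (affine_space 2) S)"

end

theory Submission
  imports Defs
begin

text \<open>
  Removing \<open>\<gamma>\<^sub>0\<close> from the complement of \<open>\<C>'\<close> is a scissor decomposition: \<open>\<M>(\<C>')\<close> is the disjoint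
  union of its closed subset \<open>\<gamma>\<^sub>0 - \<C>''\<close> and of \<open>\<M>(\<C>)\<close>. The formula is therefore one scissor
  relation, once the three pieces are known to be varieties and the subtraction is carried out in
  the quotient group.

  The curves of \<open>\<C>'\<close> are the zero locus of a single polynomial \<open>F\<close>, the product of their equations,
  and \<open>\<gamma>\<^sub>0\<close> is that of a polynomial \<open>g\<close>. Hence all three pieces have the form
  \<open>{x. h x \<noteq> 0 \<and> k x = 0}\<close>, with \<open>(h, k)\<close> equal to \<open>(F, 0)\<close>, \<open>(F, g)\<close> and \<open>(F g, 0)\<close>. Such a set is
  affine by the Rabinowitsch trick (\<open>affine_variety_principal_piece\<close>): adding the coordinate
  \<open>t = 1 / h x\<close> identifies it with the closed set \<open>t h x = 1\<close>, \<open>k x = 0\<close> one dimension up. So a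
  single chart covers it, and separatedness is witnessed by the coordinate functions
  (\<open>separated_induced\<close>).

  One technical point is that inducing a structure twice, \<open>X \<supseteq> Y \<supseteq> Z\<close>, gives the same regular
  functions on open sets as inducing it once, but not the same predicate on arbitrary sets of
  points. The relation \<open>same_structure\<close> records agreement on open sets, and every notion that
  enters the Grothendieck ring is invariant under it.
\<close>

section \<open>Structures that agree on open sets\<close>

definition same_structure :: "'a fun_space \<Rightarrow> 'a fun_space \<Rightarrow> bool" where
  "same_structure X X' \<longleftrightarrow>
     opens X = opens X' \<and> (\<forall>U f. openin (opens X) U \<longrightarrow> regular X U f = regular X' U f)"

lemma same_structure_sym: "same_structure X X' \<Longrightarrow> same_structure X' X"
  by (auto simp: same_structure_def)

lemma morphism_same_structure:
  assumes "same_structure X X'" "same_structure Y Y'" "morphism X Y \<phi>"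
  shows "morphism X' Y' \<phi>"
  unfolding morphism_def
proof (intro conjI allI impI)
  show cont: "continuous_map (opens X') (opens Y') \<phi>"
    using assms by (auto simp: morphism_def same_structure_def)
  fix V f assume V: "openin (opens Y') V \<and> regular Y' V f"
  have "openin (opens X') (points X' \<inter> \<phi> -` V)"
    using openin_continuous_map_preimage[OF cont] V by (auto simp: vimage_def Int_def)
  moreover have "regular X (points X \<inter> \<phi> -` V) (f \<circ> \<phi>)"
    using assms V unfolding morphism_def same_structure_def by metis
  ultimately show "regular X' (points X' \<inter> \<phi> -` V) (f \<circ> \<phi>)"
    using assms(1) by (simp add: same_structure_def)
qed

lemma isomorphic_same_structure:
  assumes "same_structure X X'"
  shows "isomorphic X Y = isomorphic X' Y"
proof -
  have "isomorphic B Y" if AB: "same_structure A B" "isomorphic A Y" for A B :: "'a fun_space"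
  proof -
    have YY: "same_structure Y Y" by (simp add: same_structure_def)
    have pts: "points A = points B" using AB(1) by (simp add: same_structure_def)
    show ?thesis
      using AB(2) unfolding isomorphic_def pts
      using morphism_same_structure[OF AB(1) YY] morphism_same_structure[OF YY AB(1)] by blast
  qed
  then show ?thesis using assms same_structure_sym by blast
qed

lemma induced_cong_same_structure:
  assumes "same_structure X X'"
  shows "induced X Y = induced X' Y"
proof -
  have o: "opens X = opens X'" using assms by (simp add: same_structure_def)
  have "(\<lambda>V f. \<forall>x\<in>V. \<exists>U g. openin (opens X) U \<and> x \<in> U \<and> regular X U g \<and> (\<forall>y\<in>V \<inter> U. f y = g y)) =
        (\<lambda>V f. \<forall>x\<in>V. \<exists>U g. openin (opens X') U \<and> x \<in> U \<and> regular X' U g \<and> (\<forall>y\<in>V \<inter> U. f y = g y))"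
    using assms unfolding same_structure_def by (intro ext) metis
  then show ?thesis unfolding induced_def using o by simp
qed

lemma tensor_function_cong_same_structure:
  assumes "same_structure X X'"
  shows "tensor_function X X = tensor_function X' X'"
proof (intro ext)
  fix U V h
  show "tensor_function X X U V h = tensor_function X' X' U V h"
  proof (cases "openin (opens X) U \<and> openin (opens X) V")
    case True
    then have "regular X U = regular X' U" "regular X V = regular X' V" "opens X = opens X'"
      using assms by (auto simp: same_structure_def)
    then show ?thesis unfolding tensor_function_def by simp
  next
    case False
    then show ?thesis using assms unfolding tensor_function_def same_structure_def by auto
  qed
qed

lemma complex_variety_same_structure:
  assumes "same_structure X X'" "complex_variety X"
  shows "complex_variety X'"
proof -
  have o: "opens X = opens X'" and r: "\<And>U f. openin (opens X') U \<Longrightarrow> regular X U f = regular X' U f"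
    using assms(1) by (auto simp: same_structure_def)
  have sheaf: "function_sheaf X" using assms(2) by (simp add: complex_variety_def)
  have "function_sheaf X'"
    unfolding function_sheaf_def
  proof (intro conjI allI impI)
    fix U f g
    assume "openin (opens X') U \<and> regular X' U f \<and> (\<forall>x\<in>U. f x = g x)"
    then show "regular X' U g" using sheaf r unfolding function_sheaf_def o by metis
  next
    fix U V f
    assume "openin (opens X') U \<and> openin (opens X') V \<and> V \<subseteq> U \<and> regular X' U f"
    then show "regular X' V f" using sheaf r unfolding function_sheaf_def o by metis
  next
    fix \<U> f
    assume *: "\<forall>U\<in>\<U>. openin (opens X') U \<and> regular X' U f"
    then have "openin (opens X') (\<Union>\<U>)" by blast
    moreover have "regular X (\<Union>\<U>) f" using * sheaf r unfolding function_sheaf_def o by simp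
    ultimately show "regular X' (\<Union>\<U>) f" using r by blast
  qed
  moreover have "separated X'"
    using assms(2) tensor_function_cong_same_structure[OF assms(1)]
    by (simp add: complex_variety_def separated_def fun_space_prod_def o)
  ultimately show ?thesis
    using assms(2) induced_cong_same_structure[OF assms(1)]
    by (simp add: complex_variety_def o)
qed

lemma iso_class_same_structure: "same_structure X X' \<Longrightarrow> iso_class X = iso_class X'"
  using isomorphic_same_structure unfolding iso_class_def by blast

lemma opens_induced [simp]: "opens (induced X Y) = subtopology (opens X) Y"
  by (simp add: induced_def)

lemma induced_induced_same_structure:
  assumes sheaf: "function_sheaf X" and "Z \<subseteq> Y"
  shows "same_structure (induced (induced X Y) Z) (induced X Z)"
  unfolding same_structure_def
proof (intro conjI allI impI)
  show o: "opens (induced (induced X Y) Z) = opens (induced X Z)"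
    using assms(2) by (simp add: subtopology_subtopology inf_absorb2)
  fix V f assume "openin (opens (induced (induced X Y) Z)) V"
  then have VZ: "V \<subseteq> Z" using o by (auto simp: openin_subtopology)
  show "regular (induced (induced X Y) Z) V f = regular (induced X Z) V f"
  proof
    assume *: "regular (induced (induced X Y) Z) V f"
    have "\<exists>U g. openin (opens X) U \<and> x \<in> U \<and> regular X U g \<and> (\<forall>y\<in>V \<inter> U. f y = g y)"
      if x: "x \<in> V" for x
    proof -
      obtain U' g' where U': "openin (subtopology (opens X) Y) U'" "x \<in> U'"
          "regular (induced X Y) U' g'" "\<forall>y\<in>V \<inter> U'. f y = g' y"
        using * x unfolding induced_def[of "induced X Y"] by auto
      obtain W where W: "openin (opens X) W" "U' = W \<inter> Y"
        using U'(1) by (auto simp: openin_subtopology)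
      obtain U g where U: "openin (opens X) U" "x \<in> U" "regular X U g" "\<forall>y\<in>U' \<inter> U. g' y = g y"
        using U'(2,3) unfolding induced_def by auto
      have "regular X (U \<inter> W) g"
        using sheaf U(1,3) W(1) unfolding function_sheaf_def by (metis inf_le1 openin_Int)
      moreover have "\<forall>y\<in>V \<inter> (U \<inter> W). f y = g y"
        using U(4) U'(4) W(2) VZ assms(2) by auto
      ultimately show ?thesis using U W U'(2) by (intro exI[of _ "U \<inter> W"] exI[of _ g]) auto
    qed
    then show "regular (induced X Z) V f" by (simp add: induced_def)
  next
    assume *: "regular (induced X Z) V f"
    have "\<exists>U g. openin (subtopology (opens X) Y) U \<and> x \<in> U \<and> regular (induced X Y) U g \<and>
            (\<forall>y\<in>V \<inter> U. f y = g y)" if x: "x \<in> V" for x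
    proof -
      obtain U g where U: "openin (opens X) U" "x \<in> U" "regular X U g" "\<forall>y\<in>V \<inter> U. f y = g y"
        using * x unfolding induced_def by auto
      have "regular (induced X Y) (U \<inter> Y) g" using U(1,3) unfolding induced_def by auto
      then show ?thesis using U x VZ assms(2)
        by (intro exI[of _ "U \<inter> Y"] exI[of _ g]) (auto simp: openin_subtopology)
    qed
    then show "regular (induced (induced X Y) Z) V f"
      unfolding induced_def[of "induced X Y"] by simp
  qed
qed

lemma function_sheaf_induced:
  assumes sheaf: "function_sheaf X"
  shows "function_sheaf (induced X Y)"
  unfolding function_sheaf_def
proof (intro conjI allI impI)
  fix U f g
  assume "openin (opens (induced X Y)) U \<and> regular (induced X Y) U f \<and> (\<forall>x\<in>U. f x = g x)"
  then show "regular (induced X Y) U g" unfolding induced_def by simp (metis IntD1)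
next
  fix U V f
  assume "openin (opens (induced X Y)) U \<and> openin (opens (induced X Y)) V \<and> V \<subseteq> U \<and>
    regular (induced X Y) U f"
  then show "regular (induced X Y) V f" unfolding induced_def by simp blast
next
  fix \<U> f
  assume *: "\<forall>U\<in>\<U>. openin (opens (induced X Y)) U \<and> regular (induced X Y) U f"
  have "\<exists>N g. openin (opens X) N \<and> x \<in> N \<and> regular X N g \<and> (\<forall>y\<in>\<Union>\<U> \<inter> N. f y = g y)"
    if x: "x \<in> \<Union>\<U>" for x
  proof -
    obtain U where U: "U \<in> \<U>" "x \<in> U" using x by blast
    obtain W where W: "openin (opens X) W" "U = W \<inter> Y"
      using * U(1) by (auto simp: openin_subtopology)
    obtain N g where N: "openin (opens X) N" "x \<in> N" "regular X N g" "\<forall>y\<in>U \<inter> N. f y = g y"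
      using * U unfolding induced_def by simp metis
    have "regular X (N \<inter> W) g"
      using sheaf N(1,3) W(1) unfolding function_sheaf_def by (metis inf_le1 openin_Int)
    moreover have "\<Union>\<U> \<subseteq> Y" using * by (auto simp: openin_subtopology)
    ultimately show ?thesis using N W U(2) by (intro exI[of _ "N \<inter> W"] exI[of _ g]) auto
  qed
  then show "regular (induced X Y) (\<Union>\<U>) f"
    unfolding induced_def fun_space.simps by (intro ballI)
qed


section \<open>Regular functions on subsets of affine space\<close>

lemma polynomial_functions_uminus:
  "p \<in> polynomial_functions \<Longrightarrow> (\<lambda>x. - p x) \<in> polynomial_functions"
  using mult[OF const[of "-1"]] by simp

lemma polynomial_functions_diff:
  "p \<in> polynomial_functions \<Longrightarrow> q \<in> polynomial_functions
    \<Longrightarrow> (\<lambda>x. p x - q x) \<in> polynomial_functions"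
  using add[OF _ polynomial_functions_uminus] by simp

lemmas polynomial_functions_intros =
  polynomial_functions.intros polynomial_functions_diff

lemma polynomial_functions_subst:
  assumes "p \<in> polynomial_functions" "\<And>i. (\<lambda>x. h x i) \<in> polynomial_functions"
  shows "(\<lambda>x. p (h x)) \<in> polynomial_functions"
  using assms(1) by induction (auto intro: polynomial_functions.intros assms(2))

lemma openin_principal:
  "p \<in> polynomial_functions \<Longrightarrow> openin (opens (affine_space n)) {x \<in> affine_points n. p x \<noteq> 0}"
  unfolding affine_space_def by (auto intro!: topology_generated_by_Basis)

lemma points_affine_space [simp]: "points (affine_space n) = affine_points n"
proof
  show "points (affine_space n) \<subseteq> affine_points n" by (auto simp: affine_space_def)
  show "affine_points n \<subseteq> points (affine_space n)"
    using openin_subset[OF openin_principal[OF const[of 1], of n]] by simp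
qed

text \<open>
  The principal open sets are closed under intersection because polynomials multiply, so they
  form a basis and not only a subbasis of the Zariski topology.
\<close>

lemma principal_open_neighbourhood:
  assumes "openin (opens (affine_space n)) U" "x \<in> U"
  obtains r where "r \<in> polynomial_functions" "r x \<noteq> 0" "{y \<in> affine_points n. r y \<noteq> 0} \<subseteq> U"
proof -
  have "generate_topology_on {{x \<in> affine_points n. p x \<noteq> 0} | p. p \<in> polynomial_functions} U"
    using assms(1) by (simp add: affine_space_def openin_topology_generated_by_iff)
  then have "\<exists>r\<in>polynomial_functions. r x \<noteq> 0 \<and> {y \<in> affine_points n. r y \<noteq> 0} \<subseteq> U"
    using assms(2)
  proof induction
    case (Int a b)
    then obtain r s where "r \<in> polynomial_functions" "r x \<noteq> 0" "{y \<in> affine_points n. r y \<noteq> 0} \<subseteq> a"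
      "s \<in> polynomial_functions" "s x \<noteq> 0" "{y \<in> affine_points n. s y \<noteq> 0} \<subseteq> b" by auto
    then show ?case by (intro bexI[OF _ mult[of r s]]) auto
  next
    case (UN K)
    then show ?case by blast
  qed auto
  then show ?thesis using that by blast
qed

lemma closedin_zero_set:
  assumes "p \<in> polynomial_functions"
  shows "closedin (opens (affine_space n)) {x \<in> affine_points n. p x = 0}"
proof -
  have "affine_points n - {x \<in> affine_points n. p x = 0} = {x \<in> affine_points n. p x \<noteq> 0}" by auto
  then show ?thesis using openin_principal[OF assms] by (auto simp: closedin_def)
qed

lemma regular_affine_space:
  "regular (affine_space n) U f \<longleftrightarrow>
     (\<forall>x\<in>U. \<exists>p\<in>polynomial_functions. \<exists>q\<in>polynomial_functions.
        q x \<noteq> 0 \<and> (\<forall>y\<in>U. q y \<noteq> 0 \<longrightarrow> f y = p y / q y))"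
  by (simp add: affine_space_def)

text \<open>
  A fraction that represents \<open>f\<close> only on a neighbourhood \<open>r \<noteq> 0\<close> represents it wherever its
  denominator does not vanish, after numerator and denominator are multiplied by \<open>r\<close>. This removes
  the auxiliary neighbourhoods from the description of regular functions.
\<close>

lemma regular_induced_affine:
  assumes "V \<subseteq> affine_points n"
  shows "regular (induced (affine_space n) S) V f \<longleftrightarrow>
     (\<forall>x\<in>V. \<exists>p\<in>polynomial_functions. \<exists>q\<in>polynomial_functions.
        q x \<noteq> 0 \<and> (\<forall>y\<in>V. q y \<noteq> 0 \<longrightarrow> f y = p y / q y))"
    (is "?lhs \<longleftrightarrow> ?rhs")
proof
  assume ?lhs
  show ?rhs
  proof
    fix x assume x: "x \<in> V"
    then obtain U g where U: "openin (opens (affine_space n)) U" "x \<in> U"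
      "regular (affine_space n) U g" "\<forall>y\<in>V \<inter> U. f y = g y"
      using \<open>?lhs\<close> by (auto simp: induced_def)
    obtain r where r: "r \<in> polynomial_functions" "r x \<noteq> 0" "{y \<in> affine_points n. r y \<noteq> 0} \<subseteq> U"
      using principal_open_neighbourhood[OF U(1,2)] .
    obtain p q where pq: "p \<in> polynomial_functions" "q \<in> polynomial_functions"
      "q x \<noteq> 0" "\<forall>y\<in>U. q y \<noteq> 0 \<longrightarrow> g y = p y / q y"
      using U(2,3) unfolding regular_affine_space by blast
    have "\<forall>y\<in>V. q y * r y \<noteq> 0 \<longrightarrow> f y = (p y * r y) / (q y * r y)"
      using pq(4) U(4) r(3) assms by auto
    then show "\<exists>p\<in>polynomial_functions. \<exists>q\<in>polynomial_functions.
        q x \<noteq> 0 \<and> (\<forall>y\<in>V. q y \<noteq> 0 \<longrightarrow> f y = p y / q y)"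
      using pq(3) r(2) by (intro bexI[OF _ mult[OF pq(1) r(1)]] bexI[OF _ mult[OF pq(2) r(1)]]) auto
  qed
next
  assume ?rhs
  have "\<exists>U g. openin (opens (affine_space n)) U \<and> x \<in> U \<and> regular (affine_space n) U g \<and>
          (\<forall>y\<in>V \<inter> U. f y = g y)" if x: "x \<in> V" for x
  proof -
    obtain p q where pq: "p \<in> polynomial_functions" "q \<in> polynomial_functions"
      "q x \<noteq> 0" "\<forall>y\<in>V. q y \<noteq> 0 \<longrightarrow> f y = p y / q y"
      using \<open>?rhs\<close> x by blast
    have "regular (affine_space n) {y \<in> affine_points n. q y \<noteq> 0} (\<lambda>y. p y / q y)"
      unfolding regular_affine_space using pq(1,2) by blast
    then show ?thesis
      using x assms pq(3,4) openin_principal[OF pq(2), of n]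
      by (intro exI[of _ "{y \<in> affine_points n. q y \<noteq> 0}"] exI[of _ "\<lambda>y. p y / q y"]) auto
  qed
  then show ?lhs by (simp add: induced_def)
qed

lemma function_sheaf_affine_space: "function_sheaf (affine_space n)"
  unfolding function_sheaf_def
proof (intro conjI allI impI)
  fix U f g
  assume "openin (opens (affine_space n)) U \<and> regular (affine_space n) U f \<and> (\<forall>x\<in>U. f x = g x)"
  then show "regular (affine_space n) U g" unfolding regular_affine_space by metis
next
  fix U V f
  assume "openin (opens (affine_space n)) U \<and> openin (opens (affine_space n)) V \<and> V \<subseteq> U \<and>
    regular (affine_space n) U f"
  then have V: "V \<subseteq> U" and f: "regular (affine_space n) U f" by auto
  show "regular (affine_space n) V f"
    unfolding regular_affine_space
  proof
    fix x assume "x \<in> V"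
    then obtain p q where "p \<in> polynomial_functions" "q \<in> polynomial_functions"
      "q x \<noteq> 0" "\<forall>y\<in>U. q y \<noteq> 0 \<longrightarrow> f y = p y / q y"
      using V f unfolding regular_affine_space by blast
    then show "\<exists>p\<in>polynomial_functions. \<exists>q\<in>polynomial_functions.
        q x \<noteq> 0 \<and> (\<forall>y\<in>V. q y \<noteq> 0 \<longrightarrow> f y = p y / q y)"
      using V by blast
  qed
next
  fix \<U> f
  assume *: "\<forall>U\<in>\<U>. openin (opens (affine_space n)) U \<and> regular (affine_space n) U f"
  then have "\<Union>\<U> \<subseteq> affine_points n" using openin_subset by fastforce
  \<comment> \<open>Regularity in an induced structure is local by definition, and it coincides with regularity
    in affine space itself.\<close>
  then have "regular (induced (affine_space n) S) (\<Union>\<U>) f \<longleftrightarrow> regular (affine_space n) (\<Union>\<U>) f" for S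
    by (simp only: regular_induced_affine regular_affine_space)
  moreover have "regular (induced (affine_space n) UNIV) (\<Union>\<U>) f"
    using * by (auto simp: induced_def)
  ultimately show "regular (affine_space n) (\<Union>\<U>) f" by blast
qed


section \<open>Maps with rational coordinates\<close>

definition rational_on :: "point set \<Rightarrow> (point \<Rightarrow> complex) \<Rightarrow> bool" where
  "rational_on S f \<longleftrightarrow> (\<exists>p\<in>polynomial_functions. \<exists>q\<in>polynomial_functions.
     \<forall>x\<in>S. q x \<noteq> 0 \<and> f x = p x / q x)"

lemma rational_onI:
  "\<lbrakk>p \<in> polynomial_functions; q \<in> polynomial_functions; \<And>x. x \<in> S \<Longrightarrow> q x \<noteq> 0 \<and> f x = p x / q x\<rbrakk>
    \<Longrightarrow> rational_on S f"
  by (auto simp: rational_on_def)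

lemma rational_on_polynomial: "p \<in> polynomial_functions \<Longrightarrow> rational_on S p"
  by (rule rational_onI[OF _ const[of 1]]) auto

lemma rational_on_add:
  assumes "rational_on S f" "rational_on S g"
  shows "rational_on S (\<lambda>x. f x + g x)"
proof -
  obtain p q p' q' where *: "p \<in> polynomial_functions" "q \<in> polynomial_functions"
    "\<forall>x\<in>S. q x \<noteq> 0 \<and> f x = p x / q x" "p' \<in> polynomial_functions" "q' \<in> polynomial_functions"
    "\<forall>x\<in>S. q' x \<noteq> 0 \<and> g x = p' x / q' x"
    using assms unfolding rational_on_def by blast
  show ?thesis
    by (rule rational_onI[OF add[OF mult[OF *(1,5)] mult[OF *(4,2)]] mult[OF *(2,5)]])
       (use *(3,6) in \<open>simp add: add_frac_eq\<close>)
qed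

lemma rational_on_mult:
  assumes "rational_on S f" "rational_on S g"
  shows "rational_on S (\<lambda>x. f x * g x)"
proof -
  obtain p q p' q' where *: "p \<in> polynomial_functions" "q \<in> polynomial_functions"
    "\<forall>x\<in>S. q x \<noteq> 0 \<and> f x = p x / q x" "p' \<in> polynomial_functions" "q' \<in> polynomial_functions"
    "\<forall>x\<in>S. q' x \<noteq> 0 \<and> g x = p' x / q' x"
    using assms unfolding rational_on_def by blast
  show ?thesis
    by (rule rational_onI[OF mult[OF *(1,4)] mult[OF *(2,5)]]) (use *(3,6) in simp)
qed

lemma rational_on_polynomial_comp:
  assumes "p \<in> polynomial_functions" "\<And>i. rational_on S (\<lambda>x. \<phi> x i)"
  shows "rational_on S (\<lambda>x. p (\<phi> x))"
  using assms(1)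
  by induction (auto intro: rational_on_add rational_on_mult rational_on_polynomial
      polynomial_functions.const assms(2))

text \<open>
  Pulling a polynomial back along such a map gives a fraction whose denominator has no zeros on the
  source. So preimages of principal open sets are cut out by the numerator, and local fractions pull
  back to local fractions.
\<close>

lemma morphism_rational_coordinates:
  assumes S: "S \<subseteq> affine_points m" and T: "T \<subseteq> affine_points n" and \<phi>: "\<phi> ` S \<subseteq> T"
    and rat: "\<And>i. rational_on S (\<lambda>x. \<phi> x i)"
  shows "morphism (induced (affine_space m) S) (induced (affine_space n) T) \<phi>"
proof -
  have ptS: "points (induced (affine_space m) S) = S" using S by auto
  have ptT: "points (induced (affine_space n) T) = T" using T by auto
  have comp: "\<exists>P\<in>polynomial_functions. \<exists>Q\<in>polynomial_functions.
      \<forall>x\<in>S. Q x \<noteq> 0 \<and> p (\<phi> x) = P x / Q x" if "p \<in> polynomial_functions" for p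
    using rational_on_polynomial_comp[OF that rat] unfolding rational_on_def .
  have cont: "continuous_map (opens (induced (affine_space m) S)) (opens (induced (affine_space n) T)) \<phi>"
    unfolding continuous_map_def ptS ptT
  proof (intro conjI allI impI)
    show "\<phi> \<in> S \<rightarrow> T" using \<phi> by auto
    fix V assume V: "openin (opens (induced (affine_space n) T)) V"
    show "openin (opens (induced (affine_space m) S)) {x \<in> S. \<phi> x \<in> V}"
    proof (subst openin_subopen, intro ballI)
      fix x assume x: "x \<in> {x \<in> S. \<phi> x \<in> V}"
      obtain W where W: "openin (opens (affine_space n)) W" "V = W \<inter> T"
        using V by (auto simp: openin_subtopology)
      obtain r where r: "r \<in> polynomial_functions" "r (\<phi> x) \<noteq> 0"
        "{y \<in> affine_points n. r y \<noteq> 0} \<subseteq> W"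
        using principal_open_neighbourhood[OF W(1)] x W(2) by blast
      obtain P Q where P: "P \<in> polynomial_functions" "\<forall>x\<in>S. Q x \<noteq> 0 \<and> r (\<phi> x) = P x / Q x"
        using comp[OF r(1)] by blast
      have "openin (opens (induced (affine_space m) S)) ({y \<in> affine_points m. P y \<noteq> 0} \<inter> S)"
        using openin_principal[OF P(1)] by (auto simp: openin_subtopology)
      moreover have "x \<in> {y \<in> affine_points m. P y \<noteq> 0} \<inter> S" using x S P(2) r(2) by auto
      moreover have "{y \<in> affine_points m. P y \<noteq> 0} \<inter> S \<subseteq> {x \<in> S. \<phi> x \<in> V}"
      proof
        fix y assume y: "y \<in> {y \<in> affine_points m. P y \<noteq> 0} \<inter> S"
        then have "r (\<phi> y) \<noteq> 0" using P(2) by auto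
        moreover have "\<phi> y \<in> T" using y \<phi> by auto
        ultimately show "y \<in> {x \<in> S. \<phi> x \<in> V}" using r(3) T W(2) y by auto
      qed
      ultimately show "\<exists>U. openin (opens (induced (affine_space m) S)) U \<and> x \<in> U \<and>
          U \<subseteq> {x \<in> S. \<phi> x \<in> V}" by blast
    qed
  qed
  have "regular (induced (affine_space m) S) (S \<inter> \<phi> -` V) (f \<circ> \<phi>)"
    if V: "openin (opens (induced (affine_space n) T)) V" "regular (induced (affine_space n) T) V f"
    for V f
  proof -
    have VT: "V \<subseteq> affine_points n" using V(1) T by (auto simp: openin_subtopology)
    have "S \<inter> \<phi> -` V \<subseteq> affine_points m" using S by auto
    moreover have "\<exists>p\<in>polynomial_functions. \<exists>q\<in>polynomial_functions.
        q x \<noteq> 0 \<and> (\<forall>y\<in>S \<inter> \<phi> -` V. q y \<noteq> 0 \<longrightarrow> (f \<circ> \<phi>) y = p y / q y)"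
      if x: "x \<in> S \<inter> \<phi> -` V" for x
    proof -
      have "\<phi> x \<in> V" using x by auto
      then obtain p q where pq: "p \<in> polynomial_functions" "q \<in> polynomial_functions"
        "q (\<phi> x) \<noteq> 0" "\<forall>y\<in>V. q y \<noteq> 0 \<longrightarrow> f y = p y / q y"
        using V(2) unfolding regular_induced_affine[OF VT] by blast
      obtain P Q where P: "P \<in> polynomial_functions" "Q \<in> polynomial_functions"
        "\<forall>x\<in>S. Q x \<noteq> 0 \<and> p (\<phi> x) = P x / Q x" using comp[OF pq(1)] by blast
      obtain P' Q' where P': "P' \<in> polynomial_functions" "Q' \<in> polynomial_functions"
        "\<forall>x\<in>S. Q' x \<noteq> 0 \<and> q (\<phi> x) = P' x / Q' x" using comp[OF pq(2)] by blast
      \<comment> \<open>The pullback of \<open>p / q\<close> is \<open>(P / Q) / (P' / Q')\<close>.\<close>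
      have "\<forall>y\<in>S \<inter> \<phi> -` V. Q y * P' y \<noteq> 0 \<longrightarrow> (f \<circ> \<phi>) y = (P y * Q' y) / (Q y * P' y)"
        using pq(4) P(3) P'(3) by auto
      moreover have "Q x * P' x \<noteq> 0" using x pq(3) P(3) P'(3) by auto
      ultimately show ?thesis
        by (intro bexI[OF _ mult[OF P(1) P'(2)]] bexI[OF _ mult[OF P(2) P'(1)]]) auto
    qed
    ultimately show ?thesis by (simp add: regular_induced_affine)
  qed
  then show ?thesis using cont unfolding morphism_def ptS by blast
qed


section \<open>Principal pieces of affine space are varieties\<close>

definition principal_piece ::
  "nat \<Rightarrow> (point \<Rightarrow> complex) \<Rightarrow> (point \<Rightarrow> complex) \<Rightarrow> point set" where
  "principal_piece n h k = {x \<in> affine_points n. h x \<noteq> 0 \<and> k x = 0}"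

text \<open>
  The Rabinowitsch trick. The polynomials \<open>h\<close> and \<open>k\<close> may mention the coordinate \<open>n\<close>, which is zero
  on \<open>affine_points n\<close> but is the new variable one dimension up. They are therefore evaluated after
  this coordinate has been reset to zero.
\<close>

lemma isomorphic_principal_piece_closed:
  assumes h: "h \<in> polynomial_functions" and k: "k \<in> polynomial_functions"
  shows "\<exists>Z. closedin (opens (affine_space (Suc n))) Z \<and>
    isomorphic (induced (affine_space n) (principal_piece n h k)) (induced (affine_space (Suc n)) Z)"
proof -
  define \<phi> :: "point \<Rightarrow> point" where "\<phi> x = x(n := 1 / h x)" for x
  define \<psi> :: "point \<Rightarrow> point" where "\<psi> z = z(n := 0)" for z
  define S where "S = principal_piece n h k"
  define Z where "Z = {z \<in> affine_points (Suc n). z n * h (\<psi> z) - 1 = 0} \<inter>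
    {z \<in> affine_points (Suc n). k (\<psi> z) = 0}"
  have \<psi>_poly: "(\<lambda>z. \<psi> z i) \<in> polynomial_functions" for i
    by (cases "i = n") (auto simp: \<psi>_def intro: polynomial_functions.intros)
  have "closedin (opens (affine_space (Suc n))) Z"
    unfolding Z_def
    by (intro closedin_Int closedin_zero_set polynomial_functions_intros
        polynomial_functions_subst[OF h] polynomial_functions_subst[OF k] \<psi>_poly)
  moreover have "morphism (induced (affine_space n) S) (induced (affine_space (Suc n)) Z) \<phi>"
  proof (rule morphism_rational_coordinates)
    have "\<psi> (\<phi> x) = x" if "x \<in> affine_points n" for x
      using that by (auto simp: \<phi>_def \<psi>_def affine_points_def)
    then show "\<phi> ` S \<subseteq> Z"
      by (auto simp: S_def principal_piece_def Z_def) (auto simp: \<phi>_def affine_points_def)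
    show "rational_on S (\<lambda>x. \<phi> x i)" for i
    proof (cases "i = n")
      case True
      then show ?thesis
        by (intro rational_onI[OF const[of 1] h]) (auto simp: \<phi>_def S_def principal_piece_def)
    next
      case False
      then show ?thesis by (simp add: \<phi>_def rational_on_polynomial coordinate)
    qed
  qed (auto simp: S_def principal_piece_def Z_def)
  moreover have "morphism (induced (affine_space (Suc n)) Z) (induced (affine_space n) S) \<psi>"
  proof (rule morphism_rational_coordinates)
    have "\<psi> z \<in> affine_points n" if "z \<in> affine_points (Suc n)" for z
      using that by (auto simp: \<psi>_def affine_points_def)
    then show "\<psi> ` Z \<subseteq> S" by (auto simp: S_def principal_piece_def Z_def)
  qed (auto simp: S_def principal_piece_def Z_def rational_on_polynomial \<psi>_poly)
  moreover have "\<psi> (\<phi> x) = x" if "x \<in> S" for x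
    using that by (auto simp: \<phi>_def \<psi>_def S_def principal_piece_def affine_points_def)
  moreover have "\<phi> (\<psi> z) = z" if "z \<in> Z" for z
  proof -
    have e: "z n * h (\<psi> z) = 1" using that by (simp add: Z_def)
    then have "h (\<psi> z) \<noteq> 0" by auto
    with e have "1 / h (\<psi> z) = z n" by (simp add: field_simps)
    then show ?thesis by (simp add: \<phi>_def) (simp add: \<psi>_def)
  qed
  ultimately show ?thesis unfolding isomorphic_def S_def by (intro exI[of _ Z]) auto
qed

lemma affine_variety_principal_piece:
  assumes "h \<in> polynomial_functions" "k \<in> polynomial_functions"
  shows "affine_variety (induced (affine_space n) (principal_piece n h k))"
  using isomorphic_principal_piece_closed[OF assms] unfolding affine_variety_def by blast

text \<open>
  Two distinct points differ in some coordinate \<open>i\<close>, and \<open>(x, y) \<mapsto> x i - y i\<close> is a tensor function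
  that vanishes on the diagonal.
\<close>

lemma separated_induced:
  assumes S: "S \<subseteq> affine_points n"
  shows "separated (induced (affine_space n) S)"
proof -
  let ?X = "induced (affine_space n) S"
  let ?T = "opens (fun_space_prod ?X ?X)"
  have ptS: "points ?X = S" using S by auto
  have oS: "openin (opens ?X) S" using openin_topspace[of "opens ?X"] ptS by simp
  have reg: "regular ?X S p" if p: "p \<in> polynomial_functions" for p
    unfolding regular_induced_affine[OF S]
    by (intro ballI bexI[OF _ p] bexI[OF _ const[of 1]]) auto
  have coord: "tensor_function ?X ?X S S (\<lambda>(x, y). x i - y i)" for i
    unfolding tensor_function_def
    by (intro conjI oS exI[of _ "2::nat"] exI[of _ "\<lambda>j x. if j = 0 then x i else - 1"]
        exI[of _ "\<lambda>j y. if j = 0 then 1 else y i"])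
      (auto simp: numeral_2_eq_2 less_Suc_eq intro!: reg polynomial_functions.intros)
  have one: "tensor_function ?X ?X S S (\<lambda>z. 1)"
    unfolding tensor_function_def
    by (intro conjI oS exI[of _ "1::nat"] exI[of _ "\<lambda>j x. 1"])
      (auto intro!: reg polynomial_functions.intros)
  have basic: "openin ?T {z \<in> U \<times> V. h z \<noteq> 0}" if "tensor_function ?X ?X U V h" for U V h
    unfolding fun_space_prod_def using that by (auto intro!: topology_generated_by_Basis)
  have top: "topspace ?T = S \<times> S"
  proof
    show "topspace ?T \<subseteq> S \<times> S"
    proof
      fix z assume "z \<in> topspace ?T"
      then obtain U V h where "tensor_function ?X ?X U V h" "z \<in> U \<times> V"
        by (auto simp: fun_space_prod_def)
      then show "z \<in> S \<times> S"
        unfolding tensor_function_def using openin_subset[of "opens ?X"] ptS by blast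
    qed
    show "S \<times> S \<subseteq> topspace ?T" using openin_subset[OF basic[OF one]] by simp
  qed
  have "openin ?T (\<Union>i. {z \<in> S \<times> S. (case z of (x, y) \<Rightarrow> x i - y i) \<noteq> 0})"
    using basic[OF coord] by blast
  moreover have "(\<Union>i. {z \<in> S \<times> S. (case z of (x, y) \<Rightarrow> x i - y i) \<noteq> 0}) =
      S \<times> S - {(x, x) | x. x \<in> S}" by (auto simp: fun_eq_iff)
  ultimately have "openin ?T (topspace ?T - {(x, x) | x. x \<in> S})" using top by simp
  then show ?thesis unfolding separated_def ptS closedin_def using top by auto
qed

lemma complex_variety_principal_piece:
  assumes "h \<in> polynomial_functions" "k \<in> polynomial_functions"
  shows "complex_variety (induced (affine_space n) (principal_piece n h k))"
proof -
  let ?S = "principal_piece n h k"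
  let ?X = "induced (affine_space n) ?S"
  have S: "?S \<subseteq> affine_points n" by (auto simp: principal_piece_def)
  then have pt: "points ?X = ?S" by auto
  have "same_structure (induced ?X ?S) ?X"
    by (rule induced_induced_same_structure[OF function_sheaf_affine_space order_refl])
  then have "affine_variety (induced ?X ?S)"
    using affine_variety_principal_piece[OF assms, of n] isomorphic_same_structure
    unfolding affine_variety_def by blast
  moreover have "openin (opens ?X) ?S" using openin_topspace[of "opens ?X"] pt by simp
  ultimately have "\<exists>\<U>. finite \<U> \<and> \<Union>\<U> = points ?X \<and>
      (\<forall>U\<in>\<U>. openin (opens ?X) U \<and> affine_variety (induced ?X U))"
    unfolding pt by (intro exI[of _ "{?S}"]) auto
  moreover have "function_sheaf ?X" by (rule function_sheaf_induced[OF function_sheaf_affine_space])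
  ultimately show ?thesis
    unfolding complex_variety_def using separated_induced[OF S] by (intro conjI)
qed


section \<open>Scissor relations in the Grothendieck ring\<close>

lemma frag_iso_class_in_class_group:
  fixes X :: "point fun_space"
  assumes "complex_variety X"
  shows "frag_of (iso_class X) \<in> carrier class_group"
  using assms by (auto simp: iso_classes_def)

lemma scissor_relations_subset: "scissor_relations \<subseteq> carrier class_group"
proof
  interpret group class_group by simp
  fix r assume "r \<in> scissor_relations"
  then obtain X :: "point fun_space" and Z where
    r: "r = frag_of (iso_class X)
        - (frag_of (iso_class (induced X Z)) + frag_of (iso_class (induced X (points X - Z))))"
    and "complex_variety X" "complex_variety (induced X Z)"
      "complex_variety (induced X (points X - Z))"
    by (auto simp: scissor_relations_def closed_subvariety_def open_subvariety_def)
  then have mem: "frag_of (iso_class X) \<in> carrier class_group"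
    "frag_of (iso_class (induced X Z)) \<in> carrier class_group"
    "frag_of (iso_class (induced X (points X - Z))) \<in> carrier class_group"
    by (simp_all only: frag_iso_class_in_class_group)
  have "frag_of (iso_class (induced X Z)) + frag_of (iso_class (induced X (points X - Z)))
      \<in> carrier class_group"
    using m_closed[OF mem(2,3)] by (simp only: mult_free_Abelian_group)
  then show "r \<in> carrier class_group"
    using mem(1) unfolding r carrier_free_Abelian_group_iff
    by (intro subset_trans[OF keys_diff] Un_least)
qed

lemma normal_scissor_subgroup: "scissor_subgroup \<lhd> class_group"
proof -
  interpret comm_group class_group by (rule abelian_free_Abelian_group)
  show ?thesis
    unfolding scissor_subgroup_def
    by (intro subgroup_imp_normal generate_is_subgroup scissor_relations_subset)
qed

lemma K0_minus_cosets:
  assumes a: "a \<in> carrier class_group" and b: "b \<in> carrier class_group"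
  shows "(scissor_subgroup #>\<^bsub>class_group\<^esub> a) \<ominus>\<^bsub>K0_Var\<^esub> (scissor_subgroup #>\<^bsub>class_group\<^esub> b) =
    scissor_subgroup #>\<^bsub>class_group\<^esub> (a - b)"
proof -
  interpret normal scissor_subgroup class_group by (rule normal_scissor_subgroup)
  have "add_monoid K0_Var = class_group Mod scissor_subgroup"
    by (simp add: K0_Var_def FactGroup_def)
  moreover have "scissor_subgroup #>\<^bsub>class_group\<^esub> b \<in> carrier (class_group Mod scissor_subgroup)"
    using b by (auto simp only: carrier_FactGroup)
  ultimately have "\<ominus>\<^bsub>K0_Var\<^esub> (scissor_subgroup #>\<^bsub>class_group\<^esub> b) =
      scissor_subgroup #>\<^bsub>class_group\<^esub> (inv\<^bsub>class_group\<^esub> b)"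
    using inv_FactGroup rcos_inv[OF b] by (simp only: a_inv_def)
  moreover have "A \<oplus>\<^bsub>K0_Var\<^esub> B = A <#>\<^bsub>class_group\<^esub> B" for A B by (simp add: K0_Var_def)
  ultimately have "(scissor_subgroup #>\<^bsub>class_group\<^esub> a) \<ominus>\<^bsub>K0_Var\<^esub>
      (scissor_subgroup #>\<^bsub>class_group\<^esub> b) =
      scissor_subgroup #>\<^bsub>class_group\<^esub> (a \<otimes>\<^bsub>class_group\<^esub> inv\<^bsub>class_group\<^esub> b)"
    by (simp only: a_minus_def rcos_sum[OF a inv_closed[OF b]])
  then show ?thesis using b by simp
qed

lemma K0_class_open_complement:
  fixes X :: "point fun_space"
  assumes X: "complex_variety X" and Z: "closed_subvariety X Z"
    and U: "open_subvariety X (points X - Z)"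
  shows "K0_class (induced X (points X - Z)) = K0_class X \<ominus>\<^bsub>K0_Var\<^esub> K0_class (induced X Z)"
proof -
  interpret normal scissor_subgroup class_group by (rule normal_scissor_subgroup)
  let ?x = "frag_of (iso_class X)" and ?z = "frag_of (iso_class (induced X Z))"
    and ?u = "frag_of (iso_class (induced X (points X - Z)))"
  have mem: "?x \<in> carrier class_group" "?z \<in> carrier class_group" "?u \<in> carrier class_group"
    using X Z U unfolding closed_subvariety_def open_subvariety_def
    by (simp_all only: frag_iso_class_in_class_group)
  have "?x - (?z + ?u) \<in> scissor_subgroup"
    unfolding scissor_subgroup_def
    by (rule generate.incl) (use assms in \<open>auto simp: scissor_relations_def\<close>)
  then have "(?x - (?z + ?u)) \<otimes>\<^bsub>class_group\<^esub> ?u \<in> scissor_subgroup #>\<^bsub>class_group\<^esub> ?u"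
    by (auto simp only: r_coset_def)
  then have "?x - ?z \<in> scissor_subgroup #>\<^bsub>class_group\<^esub> ?u" by (simp add: algebra_simps)
  then have "scissor_subgroup #>\<^bsub>class_group\<^esub> ?u = scissor_subgroup #>\<^bsub>class_group\<^esub> (?x - ?z)"
    using repr_independence[OF _ mem(3) subgroup_axioms] by blast
  then show ?thesis
    unfolding K0_class_def using K0_minus_cosets[OF mem(1,2)] by simp
qed

text \<open>
  The class of the piece \<open>h k \<noteq> 0\<close>, cut from the principal open set \<open>h \<noteq> 0\<close> along \<open>k = 0\<close>. The
  structures induced from the plane and from the larger piece are exchanged by \<open>same_structure\<close>.
\<close>

lemma plane_class_remove_zero_set:
  assumes h: "h \<in> polynomial_functions" and k: "k \<in> polynomial_functions"
  shows "plane_class {x \<in> affine_points 2. h x \<noteq> 0 \<and> k x \<noteq> 0} =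
    plane_class {x \<in> affine_points 2. h x \<noteq> 0} \<ominus>\<^bsub>K0_Var\<^esub>
    plane_class {x \<in> affine_points 2. h x \<noteq> 0 \<and> k x = 0}"
proof -
  let ?A = "affine_space 2"
  let ?S = "{x \<in> affine_points 2. h x \<noteq> 0}"
    and ?Z = "{x \<in> affine_points 2. h x \<noteq> 0 \<and> k x = 0}"
    and ?U = "{x \<in> affine_points 2. h x \<noteq> 0 \<and> k x \<noteq> 0}"
  let ?X = "induced ?A ?S"
  have pieces: "?S = principal_piece 2 h (\<lambda>x. 0)" "?Z = principal_piece 2 h k"
    "?U = principal_piece 2 (\<lambda>x. h x * k x) (\<lambda>x. 0)"
    by (auto simp: principal_piece_def)
  have var: "complex_variety ?X" "complex_variety (induced ?A ?Z)" "complex_variety (induced ?A ?U)"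
    unfolding pieces
    by (intro complex_variety_principal_piece h k polynomial_functions.intros)+
  have same: "same_structure (induced ?X ?Z) (induced ?A ?Z)"
    "same_structure (induced ?X ?U) (induced ?A ?U)"
    by (intro induced_induced_same_structure function_sheaf_affine_space; blast)+
  have pt: "points ?X = ?S" by auto
  have diff: "points ?X - ?Z = ?U" unfolding pt by auto
  have "closedin (opens ?X) ?Z"
    using closedin_zero_set[OF k, of 2] unfolding opens_induced closedin_subtopology
    by (intro exI[of _ "{x \<in> affine_points 2. k x = 0}"]) auto
  then have "closed_subvariety ?X ?Z"
    using complex_variety_same_structure[OF same_structure_sym[OF same(1)] var(2)]
    by (simp add: closed_subvariety_def)
  moreover from \<open>closedin (opens ?X) ?Z\<close> have "openin (opens ?X) (points ?X - ?Z)"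
    by (simp only: closedin_def)
  then have "open_subvariety ?X (points ?X - ?Z)"
    unfolding diff
    using complex_variety_same_structure[OF same_structure_sym[OF same(2)] var(3)]
    by (simp add: open_subvariety_def)
  ultimately have "K0_class (induced ?X (points ?X - ?Z)) =
      K0_class ?X \<ominus>\<^bsub>K0_Var\<^esub> K0_class (induced ?X ?Z)"
    by (rule K0_class_open_complement[OF var(1)])
  then show ?thesis
    unfolding diff plane_class_def using same[THEN iso_class_same_structure]
    by (simp add: K0_class_def)
qed


section \<open>Deletion and restriction for curve arrangements\<close>

lemma union_of_curves_zero_set:
  assumes "finite \<D>" "\<forall>\<gamma>\<in>\<D>. algebraic_curve \<gamma>"
  obtains F where "F \<in> polynomial_functions" "\<Union>\<D> = {x \<in> affine_points 2. F x = 0}"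
proof -
  have "\<exists>F\<in>polynomial_functions. \<Union>\<D> = {x \<in> affine_points 2. F x = 0}"
    using assms
  proof (induction rule: finite_induct)
    case empty
    show ?case by (rule bexI[OF _ const[of 1]]) auto
  next
    case (insert \<gamma> \<D>)
    obtain F where F: "F \<in> polynomial_functions" "\<Union>\<D> = {x \<in> affine_points 2. F x = 0}"
      using insert by auto
    obtain f where f: "f \<in> polynomial_functions" "\<gamma> = {x \<in> affine_points 2. f x = 0}"
      using insert.prems by (auto simp: algebraic_curve_def)
    have "\<Union>(insert \<gamma> \<D>) = {x \<in> affine_points 2. f x * F x = 0}"
      unfolding Union_insert F(2) f(2) by auto
    then show ?case by (rule bexI[OF _ mult[OF f(1) F(1)]])
  qed
  then show ?thesis by (elim bexE) (rule that)
qed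

theorem theorem8p34:
  fixes \<C> \<C>' :: "point set set" and \<gamma>\<^sub>0 \<C>'' :: "point set" and v\<^sub>0 :: nat
  assumes "curve_arrangement \<C>"
    and "\<gamma>\<^sub>0 \<in> \<C>"
    and "smooth_curve \<gamma>\<^sub>0"
    and "\<C>' = \<C> - {\<gamma>\<^sub>0}"
    and "\<forall>\<gamma>\<in>\<C>'. intersect_transversally \<gamma>\<^sub>0 \<gamma>"
    and "\<C>'' = \<Union>\<C>' \<inter> \<gamma>\<^sub>0"
    and "finite \<C>''" and "card \<C>'' = v\<^sub>0"
  shows "plane_class (complement \<C>) =
         plane_class (complement \<C>') \<ominus>\<^bsub>K0_Var\<^esub> plane_class (\<gamma>\<^sub>0 - \<C>'')"
proof -
  have "finite \<C>'" "\<forall>\<gamma>\<in>\<C>'. algebraic_curve \<gamma>"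
    using assms(1,4) by (auto simp: curve_arrangement_def)
  then obtain F where F: "F \<in> polynomial_functions" "\<Union>\<C>' = {x \<in> affine_points 2. F x = 0}"
    by (rule union_of_curves_zero_set)
  obtain g where g: "g \<in> polynomial_functions" "\<gamma>\<^sub>0 = {x \<in> affine_points 2. g x = 0}"
    using assms(1,2) by (auto simp: curve_arrangement_def algebraic_curve_def)
  have union: "\<Union>\<C> = \<Union>\<C>' \<union> \<gamma>\<^sub>0" using assms(2,4) by auto
  have "complement \<C>' = {x \<in> affine_points 2. F x \<noteq> 0}"
    "\<gamma>\<^sub>0 - \<C>'' = {x \<in> affine_points 2. F x \<noteq> 0 \<and> g x = 0}"
    "complement \<C> = {x \<in> affine_points 2. F x \<noteq> 0 \<and> g x \<noteq> 0}"
    unfolding complement_def assms(6) union F(2) g(2) by auto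
  then show ?thesis using plane_class_remove_zero_set[OF F(1) g(1)] by simp
qed

end
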